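(* Let $\mathcal{F}$ and $\mathcal{G}$ be two probability distributions on $\mathbb{R}^2$ with smooth strictly positive density functions $f$ and $\widetilde f$, respectively. Let $(\mathcal{X},\mathcal{Y})$, with $\mathcal{X}=(X_1,X_2)\sim\mathcal{F}$ and $\mathcal{Y}=(Y_1,Y_2)\sim\mathcal{G}$, be an optimal coupling of $\mathcal{F}$ and $\mathcal{G}$, and suppose that $\mathcal{Z}=(X_1,Y_2)$ has a smooth strictly positive density function $p$. Let $g$ and $h$ be the functions defined in the context from $f,\widetilde f,p$, and put $$\widehat{\mathcal{X}}=(X_1,g(X_1,Y_2)),\qquad \widehat{\mathcal{Y}}=(h(X_1,Y_2),Y_2).$$ Then $(\widehat{\mathcal{X}},\widehat{\mathcal{Y}})$ is also an optimal coupling of $\mathcal{F}$ and $\mathcal{G}$.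
   Context: All random variables are defined on a non-atomic probability space $(\Omega,\mathcal{A},\mathbf{P})$ with expectation $\mathbf{E}$. A coupling of $\mathcal{F}$ and $\mathcal{G}$ is a pair $(\mathcal{X},\mathcal{Y})$ of $\mathbb{R}^2$-valued random vectors such that $\mathcal{X}$ has distribution $\mathcal{F}$ and $\mathcal{Y}$ has distribution $\mathcal{G}$. It is optimal if it minimizes $\mathbf{E}[|\mathcal{X}-\mathcal{Y}|^2]=\mathbf{E}[(X_1-Y_1)^2+(X_2-Y_2)^2]$ among all couplings of $\mathcal{F}$ and $\mathcal{G}$. Write $f_1(x)=\int_{\mathbb{R}}f(x,t)\,dt$ (density of $X_1$) and $f_2(y)=\int_{\mathbb{R}}\widetilde f(u,y)\,du$ (density of $Y_2$). The conditional distribution functions are $$F_{X_2|X_1}(y|x)=\frac{\int_{-\infty}^y f(x,t)\,dt}{f_1(x)},\quad F_{Y_2|X_1}(y|x)=\frac{\int_{-\infty}^y p(x,t)\,dt}{f_1(x)},\quad F_{Y_1|Y_2}(x|y)=\frac{\int_{-\infty}^x\widetilde f(u,y)\,du}{f_2(y)},\quad F_{X_1|Y_2}(x|y)=\frac{\int_{-\infty}^x p(u,y)\,du}{f_2(y)}.$$ For each fixed $x$, $G(x,\cdot)$ is the inverse function of $F_{X_2|X_1}(\cdot|x)$; for each fixed $y$, $\widetilde G(\cdot,y)$ is the inverse function of $F_{Y_1|Y_2}(\cdot|y)$. Define $$g(x,y)=G(x,F_{Y_2|X_1}(y|x)),\qquad h(x,y)=\widetilde G(F_{X_1|Y_2}(x|y),y).$$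 *)

theory Defs
  imports "HOL-Probability.Probability"
begin

primrec k_times_cont_diff ::
  "nat \<Rightarrow> ('a::euclidean_space \<Rightarrow> 'b::real_normed_vector) \<Rightarrow> bool" where
  "k_times_cont_diff 0 f \<longleftrightarrow> continuous_on UNIV f"
| "k_times_cont_diff (Suc k) f \<longleftrightarrow>
     (\<exists>D. (\<forall>x. (f has_derivative D x) (at x)) \<and> (\<forall>v. k_times_cont_diff k (\<lambda>x. D x v)))"

definition smooth :: "('a::euclidean_space \<Rightarrow> 'b::real_normed_vector) \<Rightarrow> bool" where
  "smooth f \<longleftrightarrow> (\<forall>k. k_times_cont_diff k f)"

definition non_atomic :: "'w measure \<Rightarrow> bool" where
  "non_atomic M \<longleftrightarrow>
     (\<forall>A\<in>sets M. 0 < emeasure M A \<longrightarrow>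
        (\<exists>B\<in>sets M. B \<subseteq> A \<and> 0 < emeasure M B \<and> emeasure M B < emeasure M A))"

definition coupling ::
  "'w measure \<Rightarrow> (real \<times> real) measure \<Rightarrow> (real \<times> real) measure \<Rightarrow>
     ('w \<Rightarrow> real \<times> real) \<Rightarrow> ('w \<Rightarrow> real \<times> real) \<Rightarrow> bool" where
  "coupling M F G X Y \<longleftrightarrow>
     X \<in> borel_measurable M \<and> Y \<in> borel_measurable M \<and>
     distr M borel X = F \<and> distr M borel Y = G"

text \<open>The norm of \<^typ>\<open>real \<times> real\<close> is the Euclidean one. No second moments are assumed, so the
  expectation of the squared distance is taken in the extended nonnegative reals.\<close>

definition transport_cost ::
  "'w measure \<Rightarrow> ('w \<Rightarrow> real \<times> real) \<Rightarrow> ('w \<Rightarrow> real \<times> real) \<Rightarrow> ennreal" where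
  "transport_cost M X Y = (\<integral>\<^sup>+ w. ennreal ((norm (X w - Y w))\<^sup>2) \<partial>M)"

definition optimal_coupling ::
  "'w measure \<Rightarrow> (real \<times> real) measure \<Rightarrow> (real \<times> real) measure \<Rightarrow>
     ('w \<Rightarrow> real \<times> real) \<Rightarrow> ('w \<Rightarrow> real \<times> real) \<Rightarrow> bool" where
  "optimal_coupling M F G X Y \<longleftrightarrow>
     coupling M F G X Y \<and>
     (\<forall>X' Y'. coupling M F G X' Y' \<longrightarrow> transport_cost M X Y \<le> transport_cost M X' Y')"

text \<open>Below, \<open>f\<close>, \<open>ft\<close> and \<open>p\<close> are the densities of \<open>(X1, X2)\<close>, \<open>(Y1, Y2)\<close> and \<open>(X1, Y2)\<close>.\<close>

definition dens_X1 :: "(real \<times> real \<Rightarrow> real) \<Rightarrow> real \<Rightarrow> real" where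
  "dens_X1 f x = (LINT t|lborel. f (x, t))"

definition dens_Y2 :: "(real \<times> real \<Rightarrow> real) \<Rightarrow> real \<Rightarrow> real" where
  "dens_Y2 ft y = (LINT u|lborel. ft (u, y))"

definition cdf_X2_X1 :: "(real \<times> real \<Rightarrow> real) \<Rightarrow> real \<Rightarrow> real \<Rightarrow> real" where
  "cdf_X2_X1 f y x = (LINT t:{..y}|lborel. f (x, t)) / dens_X1 f x"

definition cdf_Y2_X1 ::
  "(real \<times> real \<Rightarrow> real) \<Rightarrow> (real \<times> real \<Rightarrow> real) \<Rightarrow> real \<Rightarrow> real \<Rightarrow> real" where
  "cdf_Y2_X1 f p y x = (LINT t:{..y}|lborel. p (x, t)) / dens_X1 f x"

definition cdf_Y1_Y2 :: "(real \<times> real \<Rightarrow> real) \<Rightarrow> real \<Rightarrow> real \<Rightarrow> real" where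
  "cdf_Y1_Y2 ft x y = (LINT u:{..x}|lborel. ft (u, y)) / dens_Y2 ft y"

definition cdf_X1_Y2 ::
  "(real \<times> real \<Rightarrow> real) \<Rightarrow> (real \<times> real \<Rightarrow> real) \<Rightarrow> real \<Rightarrow> real \<Rightarrow> real" where
  "cdf_X1_Y2 ft p x y = (LINT u:{..x}|lborel. p (u, y)) / dens_Y2 ft y"

text \<open>For almost every \<open>x\<close>, the map \<open>\<lambda>y. cdf_X2_X1 f y x\<close> is a bijection from the reals onto
  the open unit interval and \<open>G_inv f x\<close> is its genuine inverse there. A marginal integral may
  diverge on a null set of \<open>x\<close>; the values of \<open>G_inv f x\<close> are then arbitrary, as they are
  outside the unit interval. The same applies to \<open>Gt_inv\<close>.\<close>

definition G_inv :: "(real \<times> real \<Rightarrow> real) \<Rightarrow> real \<Rightarrow> real \<Rightarrow> real" where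
  "G_inv f x = inv (\<lambda>y. cdf_X2_X1 f y x)"

definition Gt_inv :: "(real \<times> real \<Rightarrow> real) \<Rightarrow> real \<Rightarrow> real \<Rightarrow> real" where
  "Gt_inv ft u y = inv (\<lambda>x. cdf_Y1_Y2 ft x y) u"

definition g_map ::
  "(real \<times> real \<Rightarrow> real) \<Rightarrow> (real \<times> real \<Rightarrow> real) \<Rightarrow> real \<Rightarrow> real \<Rightarrow> real" where
  "g_map f p x y = G_inv f x (cdf_Y2_X1 f p y x)"

definition h_map ::
  "(real \<times> real \<Rightarrow> real) \<Rightarrow> (real \<times> real \<Rightarrow> real) \<Rightarrow> real \<Rightarrow> real \<Rightarrow> real" where
  "h_map ft p x y = Gt_inv ft (cdf_X1_Y2 ft p x y) y"

end

theory Submission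
  imports Defs
begin

text \<open>The squared distance splits over the coordinates, and the second coordinate of the new coupling
  is handled by the one-dimensional monotone rearrangement of \<open>Y2\<close> given \<open>X1\<close>; the first is
  the same statement with the coordinates swapped. Integrating
  \<open>1{x \<le> min s t, max s t < y} + 1{y \<le> min s t, max s t < x}\<close> over \<open>s\<close> and \<open>t\<close>
  gives \<open>(x - y)\<^sup>2\<close>, so costs are compared through the probabilities \<open>P(X2 \<le> s, t < Y2)\<close>. For
  fixed \<open>s\<close> and \<open>t\<close>, monotonicity of \<open>g(x, \<cdot>)\<close> makes \<open>{x. g(x, t) \<le> s}\<close> an event \<open>A\<close> in \<open>X1\<close>
  that contains \<open>{g \<le> s, t < Y2}\<close> and on which \<open>Y2 \<le> t\<close> forces \<open>g \<le> s\<close>; since \<open>(X1, g)\<close> and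
  \<open>(X1, X2)\<close> have the same law,
  \<open>P(g \<le> s, t < Y2) = P(A, X2 \<le> s) - P(A, Y2 \<le> t) \<le> P(X2 \<le> s, t < Y2)\<close>.\<close>

section \<open>Cost comparison for monotone rearrangements on the line\<close>

text \<open>Split both sides of \<open>eq\<close> along \<open>C\<close>. On \<open>A\<close>
  without \<open>C\<close> the event \<open>P\<close> is almost sure, so it carries all the mass
  available there and \<open>Q\<close> carries at most as much. Hence on \<open>A\<close> with
  \<open>C\<close> the balance tips towards \<open>Q\<close>, and \<open>PC\<close> says that
  \<open>P\<close> with \<open>C\<close> lies inside \<open>A\<close> anyway.\<close>

lemma (in prob_space) prob_conj_le_by_swap:
  assumes [measurable]: "Measurable.pred M A" "Measurable.pred M P" "Measurable.pred M Q" "Measurable.pred M C"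
    and PC: "AE w in M. P w \<and> C w \<longrightarrow> A w"
    and AC: "AE w in M. A w \<and> \<not> C w \<longrightarrow> P w"
    and eq: "prob {w\<in>space M. A w \<and> P w} = prob {w\<in>space M. A w \<and> Q w}"
  shows "prob {w\<in>space M. P w \<and> C w} \<le> prob {w\<in>space M. Q w \<and> C w}"
proof -
  have split: "prob {w\<in>space M. A w \<and> R w}
      = prob {w\<in>space M. A w \<and> R w \<and> C w} + prob {w\<in>space M. A w \<and> R w \<and> \<not> C w}"
    if [measurable]: "Measurable.pred M R" for R
    by (subst finite_measure_Union[symmetric]) (auto intro!: arg_cong[where f=prob])
  have 1: "prob {w\<in>space M. P w \<and> C w} = prob {w\<in>space M. A w \<and> P w \<and> C w}"
    by (rule finite_measure_eq_AE) (use PC in \<open>auto elim!: AE_mp\<close>)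
  have 2: "prob {w\<in>space M. A w \<and> P w \<and> \<not> C w} = prob {w\<in>space M. A w \<and> \<not> C w}"
    by (rule finite_measure_eq_AE) (use AC in \<open>auto elim!: AE_mp\<close>)
  have 3: "prob {w\<in>space M. A w \<and> Q w \<and> \<not> C w} \<le> prob {w\<in>space M. A w \<and> \<not> C w}"
    by (rule finite_measure_mono) auto
  have 4: "prob {w\<in>space M. A w \<and> Q w \<and> C w} \<le> prob {w\<in>space M. Q w \<and> C w}"
    by (rule finite_measure_mono) auto
  show ?thesis using split[of P] split[of Q] 1 2 3 4 eq by auto
qed

text \<open>The value is the area of the square over the interval between \<open>x\<close> and
  \<open>y\<close>; at most one of the two squares is nonempty. The intervals are half-open so that
  membership of \<open>s\<close> reads as a weak inequality on the left and a strict one on the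
  right, matching complementary events of distribution functions.\<close>

lemma ennreal_square_diff_layer_cake:
  fixes x y :: real
  shows "ennreal ((x - y)\<^sup>2) =
    (\<integral>\<^sup>+s. \<integral>\<^sup>+t. indicator {x..<y} s * indicator {x..<y} t
      + indicator {y..<x} s * indicator {y..<x} t \<partial>lborel \<partial>lborel)"
proof -
  \<comment> \<open>For b < a the interval is empty and \<open>ennreal\<close> truncates the
    negative length to 0, so the formula covers both orders.\<close>
  have *: "(\<integral>\<^sup>+s. \<integral>\<^sup>+t. indicator {a..<b} s * indicator {a..<b} t \<partial>lborel \<partial>lborel)
      = ennreal (b - a) * ennreal (b - a)" for a b :: real
    by (cases "a \<le> b") (simp_all add: nn_integral_cmult nn_integral_multc ennreal_neg)
  have "ennreal ((x - y)\<^sup>2) = ennreal (y - x) * ennreal (y - x) + ennreal (x - y) * ennreal (x - y)"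
    by (cases "x \<le> y")
      (simp_all add: ennreal_neg power2_eq_square algebra_simps flip: ennreal_mult)
  then show ?thesis
    by (simp add: nn_integral_add *)
qed

text \<open>Tonelli applied to the layer-cake formula. Working with nonnegative integrals keeps this
  valid when the expected cost is infinite.\<close>

lemma (in prob_space) nn_integral_square_diff:
  fixes U V :: "'a \<Rightarrow> real"
  assumes [measurable]: "U \<in> borel_measurable M" "V \<in> borel_measurable M"
  shows "(\<integral>\<^sup>+w. ennreal ((U w - V w)\<^sup>2) \<partial>M) =
    (\<integral>\<^sup>+s. \<integral>\<^sup>+t. emeasure M {w\<in>space M. U w \<le> min s t \<and> max s t < V w}
       + emeasure M {w\<in>space M. V w \<le> min s t \<and> max s t < U w} \<partial>lborel \<partial>lborel)"
proof -
  interpret L: pair_sigma_finite lborel M ..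
  let ?I = "\<lambda>s t w. indicator {w\<in>space M. U w \<le> min s t \<and> max s t < V w} w
      + indicator {w\<in>space M. V w \<le> min s t \<and> max s t < U w} w :: ennreal"
  have "(\<integral>\<^sup>+w. ennreal ((U w - V w)\<^sup>2) \<partial>M) = (\<integral>\<^sup>+w. \<integral>\<^sup>+s. \<integral>\<^sup>+t. ?I s t w \<partial>lborel \<partial>lborel \<partial>M)"
    by (intro nn_integral_cong) (subst ennreal_square_diff_layer_cake, auto intro!: nn_integral_cong simp: indicator_def)
  also have "\<dots> = (\<integral>\<^sup>+s. \<integral>\<^sup>+w. \<integral>\<^sup>+t. ?I s t w \<partial>lborel \<partial>M \<partial>lborel)"
    by (rule L.Fubini') (simp add: indicator_def)
  also have "\<dots> = (\<integral>\<^sup>+s. \<integral>\<^sup>+t. \<integral>\<^sup>+w. ?I s t w \<partial>M \<partial>lborel \<partial>lborel)"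
    by (intro nn_integral_cong L.Fubini') (simp add: indicator_def)
  finally show ?thesis by (simp add: nn_integral_add)
qed

lemma (in prob_space) nn_integral_square_diff_monotone_map_le:
  fixes X Y Z :: "'a \<Rightarrow> real" and g :: "real \<Rightarrow> real \<Rightarrow> real"
  assumes [measurable]: "X \<in> borel_measurable M" "Y \<in> borel_measurable M" "Z \<in> borel_measurable M"
      "case_prod g \<in> borel_measurable borel"
    and mono: "AE w in M. mono (g (X w))"
    and distr: "distr M borel (\<lambda>w. (X w, g (X w) (Y w))) = distr M borel (\<lambda>w. (X w, Z w))"
  shows "(\<integral>\<^sup>+w. ennreal ((g (X w) (Y w) - Y w)\<^sup>2) \<partial>M) \<le> (\<integral>\<^sup>+w. ennreal ((Z w - Y w)\<^sup>2) \<partial>M)"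
proof -
  have [measurable]: "case_prod g \<in> borel_measurable (borel \<Otimes>\<^sub>M borel)"
    unfolding borel_prod by fact
  have meas: "(\<lambda>w. g (X w) (Y w)) \<in> borel_measurable M" "Y \<in> borel_measurable M" "Z \<in> borel_measurable M"
    by measurable
  \<comment> \<open>The equality of joint laws enters only through rectangles: an event of
    \<open>X\<close> times a half-line.\<close>
  have eq: "prob {w\<in>space M. X w \<in> A \<and> g (X w) (Y w) \<in> B} = prob {w\<in>space M. X w \<in> A \<and> Z w \<in> B}"
    if [measurable]: "A \<in> sets borel" "B \<in> sets borel" for A B
  proof -
    have "measure (distr M borel (\<lambda>w. (X w, g (X w) (Y w)))) (A \<times> B)
        = measure (distr M borel (\<lambda>w. (X w, Z w))) (A \<times> B)"
      by (simp add: distr)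
    then show ?thesis
      by (subst (asm) (1 2) measure_distr)
        (auto simp: vimage_def Int_def conj_commute conj_left_commute borel_prod[symmetric])
  qed
  have le: "prob {w\<in>space M. g (X w) (Y w) \<le> s \<and> t < Y w} \<le> prob {w\<in>space M. Z w \<le> s \<and> t < Y w}" for s t
  proof (rule prob_conj_le_by_swap[where A="\<lambda>w. g (X w) t \<le> s"])
    show "AE w in M. g (X w) (Y w) \<le> s \<and> t < Y w \<longrightarrow> g (X w) t \<le> s"
      using mono by eventually_elim (auto dest: monoD[where y="Y _"] intro: order_trans less_imp_le)
    show "AE w in M. g (X w) t \<le> s \<and> \<not> t < Y w \<longrightarrow> g (X w) (Y w) \<le> s"
      using mono by eventually_elim (auto simp: not_less dest: monoD[where x="Y _"] intro: order_trans)
    show "prob {w\<in>space M. g (X w) t \<le> s \<and> g (X w) (Y w) \<le> s} = prob {w\<in>space M. g (X w) t \<le> s \<and> Z w \<le> s}"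
      using eq[of "{x\<in>space borel. g x t \<le> s}" "{..s}"] by simp
  qed measurable
  have ge: "prob {w\<in>space M. Y w \<le> s \<and> t < g (X w) (Y w)} \<le> prob {w\<in>space M. Y w \<le> s \<and> t < Z w}" for s t
    unfolding conj_commute[of "Y _ \<le> s"]
  \<comment> \<open>The mirror image of the previous case: upper level sets of \<open>g\<close> at
    the point \<open>s\<close> now separate the event, with \<open>Y w \<le> s\<close> in the role
    of \<open>C\<close>.\<close>
  proof (rule prob_conj_le_by_swap[where A="\<lambda>w. t < g (X w) s"])
    show "AE w in M. t < g (X w) (Y w) \<and> Y w \<le> s \<longrightarrow> t < g (X w) s"
      using mono by eventually_elim (auto dest: monoD intro: less_le_trans)
    show "AE w in M. t < g (X w) s \<and> \<not> Y w \<le> s \<longrightarrow> t < g (X w) (Y w)"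
      using mono by eventually_elim (auto simp: not_le dest: monoD less_imp_le intro: less_le_trans)
    show "prob {w\<in>space M. t < g (X w) s \<and> t < g (X w) (Y w)} = prob {w\<in>space M. t < g (X w) s \<and> t < Z w}"
      using eq[of "{x\<in>space borel. t < g x s}" "{t<..}"] by simp
  qed measurable
  show ?thesis
    \<comment> \<open>The integrands are compared pointwise by \<open>le\<close> and
      \<open>ge\<close> at \<open>min s t\<close> and \<open>max s t\<close>.\<close>
    by (simp only: nn_integral_square_diff meas emeasure_eq_measure)
      (intro nn_integral_mono add_mono ennreal_leI le ge)
qed

section \<open>Cumulative integrals of strictly positive densities\<close>

lemma measure_density_eq_set_integral:
  fixes \<phi> :: "'a \<Rightarrow> real"
  assumes int: "integrable M \<phi>" and nonneg: "\<And>t. 0 \<le> \<phi> t" and [measurable]: "A \<in> sets M"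
  shows "measure (density M (\<lambda>t. ennreal (\<phi> t))) A = (LINT t:A|M. \<phi> t)"
proof -
  have [measurable]: "\<phi> \<in> borel_measurable M" using int by auto
  have "emeasure (density M (\<lambda>t. ennreal (\<phi> t))) A = (\<integral>\<^sup>+t. ennreal (indicator A t * \<phi> t) \<partial>M)"
    by (subst emeasure_density) (auto intro!: nn_integral_cong simp: indicator_def)
  also have "\<dots> = ennreal (LINT t:A|M. \<phi> t)"
    unfolding set_lebesgue_integral_def using integrable_real_mult_indicator[OF _ int, of A]
    by (subst nn_integral_eq_integral) (auto simp: nonneg mult.commute)
  finally show ?thesis
    using nonneg by (simp add: measure_def set_lebesgue_integral_def)
qed

lemma finite_borel_measure_density:
  assumes "integrable lborel \<phi>" and "\<And>t. 0 \<le> \<phi> t"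
  shows "finite_borel_measure (density lborel (\<lambda>t. ennreal (\<phi> t)))"
proof (intro finite_borel_measure.intro finite_measureI finite_borel_measure_axioms.intro)
  have "emeasure (density lborel (\<lambda>t. ennreal (\<phi> t))) UNIV = ennreal (LINT t|lborel. \<phi> t)"
    using assms by (subst emeasure_density) (auto simp: nn_integral_eq_integral)
  then show "emeasure (density lborel (\<lambda>t. ennreal (\<phi> t))) (space (density lborel (\<lambda>t. ennreal (\<phi> t)))) \<noteq> \<infinity>"
    by simp
qed simp_all

text \<open>The cumulative integral is the cdf of the measure with density \<open>\<phi>\<close>.
  Positivity of \<open>\<phi>\<close> gives positive mass to every set of positive Lebesgue measure,
  in particular to each nonempty interval, whence strictness. The measure has no atoms, so its cdf
  is continuous and the intermediate value theorem yields the range.\<close>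

lemma cumulative_integral_pos_density:
  fixes \<phi> :: "real \<Rightarrow> real"
  assumes int: "integrable lborel \<phi>" and pos: "\<And>t. 0 < \<phi> t"
  shows "strict_mono (\<lambda>y. LINT t:{..y}|lborel. \<phi> t)" (is "strict_mono ?\<Phi>")
    and "range (\<lambda>y. LINT t:{..y}|lborel. \<phi> t) = {0<..<(LINT t|lborel. \<phi> t)}"
proof -
  have [measurable]: "\<phi> \<in> borel_measurable borel" using int by auto
  define N where "N = density lborel (\<lambda>t. ennreal (\<phi> t))"
  have mN: "measure N A = (LINT t:A|lborel. \<phi> t)" if "A \<in> sets borel" for A
    unfolding N_def using that by (intro measure_density_eq_set_integral int less_imp_le[OF pos]) auto
  interpret finite_borel_measure N
    unfolding N_def by (intro finite_borel_measure_density int less_imp_le[OF pos])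
  have \<Phi>: "?\<Phi> = cdf N" by (simp add: fun_eq_iff cdf_def mN)
  have posN: "0 < measure N A" if [measurable]: "A \<in> sets borel" and "emeasure lborel A \<noteq> 0" for A
  proof (rule ccontr)
    assume "\<not> 0 < measure N A"
    then have "emeasure N A = 0" by (simp add: emeasure_eq_measure zero_less_measure_iff)
    then have "AE t in lborel. t \<in> A \<longrightarrow> ennreal (\<phi> t) = 0"
      unfolding N_def by (subst (asm) emeasure_density) (auto simp: nn_integral_0_iff_AE indicator_def)
    then have "AE t in lborel. t \<notin> A"
      by eventually_elim (use pos in \<open>auto simp: ennreal_eq_0_iff simp flip: not_less\<close>)
    then have "emeasure lborel A = 0" by (subst (asm) AE_iff_measurable[of A]) auto
    with that show False by simp
  qed
  show sm: "strict_mono ?\<Phi>"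
  proof (rule strict_monoI)
    fix a b :: real assume "a < b"
    then have "cdf N b - cdf N a = measure N {a<..b}" by (rule cdf_diff_eq)
    moreover have "0 < measure N {a<..b}" using \<open>a < b\<close> by (intro posN) auto
    ultimately show "?\<Phi> a < ?\<Phi> b" by (simp add: cdf_def mN)
  qed
  have cont: "isCont (cdf N) y" for y
  proof -
    have "emeasure N {y} = 0" unfolding N_def by (subst emeasure_density)
        (auto simp: nn_integral_0_iff_AE intro!: AE_mp[OF AE_lborel_singleton[of y]])
    then show ?thesis by (simp add: isCont_cdf measure_def)
  qed
  have tot: "measure N (space N) = (LINT t|lborel. \<phi> t)"
    using mN[of UNIV] by (simp add: N_def set_lebesgue_integral_def)
  show "range ?\<Phi> = {0<..<(LINT t|lborel. \<phi> t)}"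
  proof (intro equalityI subsetI)
    fix u assume "u \<in> range ?\<Phi>"
    then obtain y where y: "u = cdf N y" unfolding \<Phi> by auto
    \<comment> \<open>Comparing with a point on either side excludes the limit values 0 and the
      total mass.\<close>
    have "cdf N (y - 1) < cdf N y" "cdf N y < cdf N (y + 1)"
      using sm unfolding \<Phi> by (auto simp: strict_mono_less)
    then show "u \<in> {0<..<(LINT t|lborel. \<phi> t)}"
      using cdf_nonneg[of "y - 1"] cdf_bounded[of "y + 1"] tot y by auto
  next
    fix u assume u: "u \<in> {0<..<(LINT t|lborel. \<phi> t)}"
    have "eventually (\<lambda>y. cdf N y < u) at_bot" "eventually (\<lambda>y. u < cdf N y) at_top"
      using order_tendstoD(2)[OF cdf_lim_at_bot, of u] order_tendstoD(1)[OF cdf_lim_at_top, of u] u tot by auto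
    then obtain a b where "cdf N a < u" "u < cdf N b"
      by (meson eventually_happens trivial_limit_at_bot_linorder trivial_limit_at_top_linorder)
    moreover from this have "a < b" using sm unfolding \<Phi> by (metis less_trans strict_mono_less)
    ultimately obtain y where "cdf N y = u"
      using IVT[of "cdf N" a u b] cont by auto
    then show "u \<in> range ?\<Phi>" unfolding \<Phi> by auto
  qed
qed


section \<open>Level sets and measurability of the conditional quantile map\<close>

text \<open>The moving bound of integration is absorbed into the integrand, which is then jointly
  measurable; integrating out one variable preserves measurability in the parameter.\<close>

lemma measurable_set_integral_atMost:
  fixes q :: "real \<times> real \<Rightarrow> real"
  assumes "q \<in> borel_measurable (borel \<Otimes>\<^sub>M borel)"
  shows "(\<lambda>z. LINT t:{..snd z}|lborel. q (fst z, t)) \<in> borel_measurable (borel \<Otimes>\<^sub>M borel)"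
proof -
  let ?N = "(borel \<Otimes>\<^sub>M borel) \<Otimes>\<^sub>M lborel :: ((real \<times> real) \<times> real) measure"
  have "(\<lambda>w. q (fst (fst w), snd w)) \<in> borel_measurable ?N"
    by (rule measurable_compose[OF _ assms]) (auto intro!: measurable_Pair intro: measurable_compose)
  moreover have "Measurable.pred ?N (\<lambda>w. snd w \<le> snd (fst w))"
    by measurable
  ultimately have "(\<lambda>(z, t). if t \<le> snd z then q (fst z, t) else 0) \<in> borel_measurable ?N"
    unfolding case_prod_beta by (intro measurable_If) (simp_all add: pred_def)
  then have "(\<lambda>z. LINT t|lborel. (if t \<le> snd z then q (fst z, t) else 0)) \<in> borel_measurable (borel \<Otimes>\<^sub>M borel)"
    by (rule lborel.borel_measurable_lebesgue_integral)
  then show ?thesis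
    by (rule back_subst[where P="\<lambda>h. h \<in> _"])
      (auto simp: set_lebesgue_integral_def intro!: ext Bochner_Integration.integral_cong)
qed

text \<open>Division by zero makes the conditional cdf identically 0, so \<open>inv\<close> at 0
  chooses from the full predicate and returns one value common to all such \<open>x\<close>.\<close>

lemma G_inv_not_integrable:
  assumes "dens_X1 f x = 0"
  shows "G_inv f x 0 = (SOME z. True)"
  using assms by (simp add: G_inv_def inv_into_def cdf_X2_X1_def)

context
  fixes f :: "real \<times> real \<Rightarrow> real"
  assumes f_measurable: "f \<in> borel_measurable borel"
    and f_pos: "\<And>z. 0 < f z"
begin

lemma f_measurable_prod: "f \<in> borel_measurable (borel \<Otimes>\<^sub>M borel)"
  unfolding borel_prod by (rule f_measurable)

text \<open>A divergent Bochner integral has the default value 0, while a convergent one is positive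
  because the open interval below it is a range, hence nonempty. The test against 0 therefore
  detects the good fibres.\<close>

lemma dens_X1_nonzero_iff: "dens_X1 f x \<noteq> 0 \<longleftrightarrow> integrable lborel (\<lambda>t. f (x, t))"
proof
  show "dens_X1 f x \<noteq> 0 \<Longrightarrow> integrable lborel (\<lambda>t. f (x, t))"
    unfolding dens_X1_def using not_integrable_integral_eq by blast
  assume "integrable lborel (\<lambda>t. f (x, t))"
  from cumulative_integral_pos_density(2)[OF this f_pos]
  have "{0<..<dens_X1 f x} \<noteq> {}" unfolding dens_X1_def by blast
  then show "dens_X1 f x \<noteq> 0" by auto
qed

lemma dens_X1_nonneg: "0 \<le> dens_X1 f x"
  unfolding dens_X1_def by (intro Bochner_Integration.integral_nonneg less_imp_le f_pos)

lemma cdf_X2_X1_strict_mono_range: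
  assumes "dens_X1 f x \<noteq> 0"
  shows "strict_mono (\<lambda>y. cdf_X2_X1 f y x)" "range (\<lambda>y. cdf_X2_X1 f y x) = {0<..<1}"
proof -
  let ?\<Phi> = "\<lambda>y. LINT t:{..y}|lborel. f (x, t)"
  have d: "0 < dens_X1 f x" using assms dens_X1_nonneg[of x] by simp
  have int: "integrable lborel (\<lambda>t. f (x, t))" using assms by (simp add: dens_X1_nonzero_iff)
  note \<Phi> = cumulative_integral_pos_density[OF int f_pos, folded dens_X1_def]
  show "strict_mono (\<lambda>y. cdf_X2_X1 f y x)"
    using \<Phi>(1) d by (auto simp: strict_mono_def cdf_X2_X1_def divide_strict_right_mono)
  have "range (\<lambda>y. cdf_X2_X1 f y x) = (\<lambda>u. u / dens_X1 f x) ` range ?\<Phi>"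
    by (auto simp: cdf_X2_X1_def)
  also have "\<dots> = {0<..<1}"
    unfolding \<Phi>(2)
  proof (intro equalityI subsetI)
    fix v :: real assume "v \<in> {0<..<1}"
    then show "v \<in> (\<lambda>u. u / dens_X1 f x) ` {0<..<dens_X1 f x}"
      using d by (intro image_eqI[of _ _ "v * dens_X1 f x"]) auto
  qed (use d in auto)
  finally show "range (\<lambda>y. cdf_X2_X1 f y x) = {0<..<1}" .
qed

lemma cdf_X2_X1_G_inv:
  assumes "dens_X1 f x \<noteq> 0" "0 < u" "u < 1"
  shows "cdf_X2_X1 f (G_inv f x u) x = u"
  unfolding G_inv_def by (rule f_inv_into_f) (use cdf_X2_X1_strict_mono_range[OF assms(1)] assms in auto)

text \<open>Turns a level set of the choice-based inverse into a condition on the cdf, from which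
  measurability can be read off.\<close>

lemma G_inv_le_iff:
  assumes "dens_X1 f x \<noteq> 0" "0 < u" "u < 1"
  shows "G_inv f x u \<le> s \<longleftrightarrow> u \<le> cdf_X2_X1 f s x"
  using cdf_X2_X1_G_inv[OF assms] strict_mono_less_eq[OF cdf_X2_X1_strict_mono_range(1)[OF assms(1)], of "G_inv f x u" s]
  by simp

text \<open>Outside the unit interval \<^const>\<open>inv\<close> chooses from the empty predicate, hence a constant.
  This makes \<^const>\<open>g_map\<close> measurable everywhere, not just off a null set.\<close>

lemma G_inv_outside:
  assumes "dens_X1 f x \<noteq> 0" "\<not> (0 < u \<and> u < 1)"
  shows "G_inv f x u = (SOME z. False)"
proof -
  have "u \<notin> range (\<lambda>y. cdf_X2_X1 f y x)"
    unfolding cdf_X2_X1_strict_mono_range(2)[OF assms(1)] using assms(2) by auto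
  then have "(\<lambda>z. cdf_X2_X1 f z x = u) = (\<lambda>z. False)" by auto
  then show ?thesis by (simp add: G_inv_def inv_into_def)
qed

context
  fixes p :: "real \<times> real \<Rightarrow> real"
  assumes p_measurable: "p \<in> borel_measurable borel"
begin

lemma p_measurable_prod: "p \<in> borel_measurable (borel \<Otimes>\<^sub>M borel)"
  unfolding borel_prod by (rule p_measurable)

text \<open>The right-hand side involves only measurable functions and two fixed constants. On a
  fibre with zero marginal the argument of \<open>G_inv\<close> is itself a quotient by 0, hence 0,
  which leads to the first constant.\<close>

lemma g_map_le_iff:
  "g_map f p x y \<le> s \<longleftrightarrow>
    (if dens_X1 f x = 0 then (SOME z::real. True) \<le> s
     else if 0 < cdf_Y2_X1 f p y x \<and> cdf_Y2_X1 f p y x < 1 then cdf_Y2_X1 f p y x \<le> cdf_X2_X1 f s x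
     else (SOME z::real. False) \<le> s)"
proof (cases "dens_X1 f x = 0")
  case True
  then have "cdf_Y2_X1 f p y x = 0" by (simp add: cdf_Y2_X1_def)
  with True show ?thesis by (simp add: g_map_def G_inv_not_integrable)
next
  case False
  then show ?thesis
    using G_inv_le_iff[OF False, of "cdf_Y2_X1 f p y x" s] G_inv_outside[OF False, of "cdf_Y2_X1 f p y x"]
    unfolding g_map_def by presburger
qed

lemma measurable_g_map: "case_prod (g_map f p) \<in> borel_measurable borel"
proof -
  have pair: "(\<lambda>x. (x, s)) \<in> borel \<rightarrow>\<^sub>M borel \<Otimes>\<^sub>M borel" for s :: real
    by simp
  have "(\<lambda>(x, t). f (x, t)) \<in> borel_measurable (borel \<Otimes>\<^sub>M lborel)"
    using f_measurable_prod by simp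
  from lborel.borel_measurable_lebesgue_integral[OF this]
  have dens: "dens_X1 f \<in> borel_measurable borel"
    unfolding dens_X1_def[abs_def] .
  have cdf_p: "(\<lambda>z. cdf_Y2_X1 f p (snd z) (fst z)) \<in> borel_measurable (borel \<Otimes>\<^sub>M borel)"
    unfolding cdf_Y2_X1_def
    by (intro borel_measurable_divide measurable_set_integral_atMost p_measurable_prod
        measurable_compose[OF measurable_fst dens])
  have "(\<lambda>x. cdf_X2_X1 f s x) \<in> borel_measurable borel" for s
    unfolding cdf_X2_X1_def
    using measurable_compose[OF pair measurable_set_integral_atMost[OF f_measurable_prod], of s]
    by (intro borel_measurable_divide dens) simp
  note [measurable] = dens cdf_p this
  have "case_prod (g_map f p) \<in> borel_measurable (borel \<Otimes>\<^sub>M borel)"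
  proof (rule borel_measurableI_le)
    fix s
    show "{z \<in> space (borel \<Otimes>\<^sub>M borel). case_prod (g_map f p) z \<le> s} \<in> sets (borel \<Otimes>\<^sub>M borel)"
      unfolding case_prod_beta g_map_le_iff by measurable
  qed
  then show ?thesis by (simp add: borel_prod)
qed

end

end

section \<open>Transport along a single fibre with matching marginals\<close>

context
  fixes f p :: "real \<times> real \<Rightarrow> real" and x :: real
  assumes f_measurable: "f \<in> borel_measurable borel"
    and f_pos: "\<And>z. 0 < f z"
    and p_measurable: "p \<in> borel_measurable borel"
    and p_pos: "\<And>z. 0 < p z"
    and dens: "dens_X1 f x \<noteq> 0" "dens_X1 p x = dens_X1 f x"
begin

text \<open>Equal marginals make this a genuine conditional cdf of \<open>p\<close>, so the facts
  about \<open>cdf_X2_X1\<close> apply with \<open>p\<close> in place of \<open>f\<close>.\<close>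

lemma cdf_Y2_X1_eq: "cdf_Y2_X1 f p y x = cdf_X2_X1 p y x"
  by (simp add: cdf_Y2_X1_def cdf_X2_X1_def dens)

lemma p_fiber:
  shows "strict_mono (\<lambda>y. cdf_X2_X1 p y x)" "range (\<lambda>y. cdf_X2_X1 p y x) = {0<..<1}"
    "integrable lborel (\<lambda>t. p (x, t))"
proof -
  have "dens_X1 p x \<noteq> 0" by (simp add: dens)
  then show "strict_mono (\<lambda>y. cdf_X2_X1 p y x)" "range (\<lambda>y. cdf_X2_X1 p y x) = {0<..<1}"
    "integrable lborel (\<lambda>t. p (x, t))"
    by (rule cdf_X2_X1_strict_mono_range[OF p_measurable p_pos]
        dens_X1_nonzero_iff[OF p_measurable p_pos, THEN iffD1])+
qed

text \<open>Conditional cdf values of \<open>p\<close> lie strictly between 0 and 1, so the default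
  branches never occur.\<close>

lemma g_map_le_iff_fiber: "g_map f p x y \<le> s \<longleftrightarrow> cdf_X2_X1 p y x \<le> cdf_X2_X1 f s x"
proof -
  have "cdf_X2_X1 p y x \<in> {0<..<1}" using p_fiber(2) by blast
  then show ?thesis by (simp add: g_map_le_iff[OF f_measurable f_pos p_measurable] cdf_Y2_X1_eq dens)
qed

lemma mono_g_map: "mono (g_map f p x)"
proof
  fix y y' :: real assume "y \<le> y'"
  then have "cdf_X2_X1 p y x \<le> cdf_X2_X1 p y' x"
    by (simp add: strict_mono_less_eq[OF p_fiber(1)])
  \<comment> \<open>The level-set equivalence is applied with the value at \<open>y'\<close> itself
    as threshold.\<close>
  also have "\<dots> \<le> cdf_X2_X1 f (g_map f p x y') x"
    using g_map_le_iff_fiber[of y' "g_map f p x y'"] by simp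
  finally show "g_map f p x y \<le> g_map f p x y'"
    by (simp add: g_map_le_iff_fiber)
qed

text \<open>Quantile transform on the fibre: the level set of \<open>g_map f p x\<close> below
  \<open>s\<close> is the half-line up to the point where the conditional cdf of \<open>p\<close>
  equals that of \<open>f\<close> at \<open>s\<close>. Both sides are finite measures with the same
  cdf.\<close>

lemma distr_g_map:
  "distr (density lborel (\<lambda>t. ennreal (p (x, t)))) borel (g_map f p x)
    = density lborel (\<lambda>t. ennreal (f (x, t)))"
proof (rule cdf_unique')
  have [measurable]: "g_map f p x \<in> borel_measurable borel"
    by (intro borel_measurable_mono mono_g_map)
  have intf: "integrable lborel (\<lambda>t. f (x, t))" using dens by (simp add: dens_X1_nonzero_iff[OF f_measurable f_pos])
  interpret p: finite_borel_measure "density lborel (\<lambda>t. ennreal (p (x, t)))"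
    by (intro finite_borel_measure_density p_fiber less_imp_le[OF p_pos])
  show "finite_borel_measure (distr (density lborel (\<lambda>t. ennreal (p (x, t)))) borel (g_map f p x))"
    by (intro finite_borel_measure.intro p.finite_measure_distr finite_borel_measure_axioms.intro) auto
  show "finite_borel_measure (density lborel (\<lambda>t. ennreal (f (x, t))))"
    by (intro finite_borel_measure_density intf less_imp_le[OF f_pos])
  show "cdf (distr (density lborel (\<lambda>t. ennreal (p (x, t)))) borel (g_map f p x))
      = cdf (density lborel (\<lambda>t. ennreal (f (x, t))))"
  proof
    fix s
    \<comment> \<open>Both conditional cdfs have the open unit interval as range, so a matching
      \<open>y\<close> exists.\<close>
    have "cdf_X2_X1 f s x \<in> range (\<lambda>y. cdf_X2_X1 p y x)"
      unfolding p_fiber(2) using cdf_X2_X1_strict_mono_range(2)[OF f_measurable f_pos dens(1)] by blast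
    then obtain y where y: "cdf_X2_X1 f s x = cdf_X2_X1 p y x" by auto
    have "{t. g_map f p x t \<le> s} = {..y}"
      by (auto simp: g_map_le_iff_fiber y strict_mono_less_eq[OF p_fiber(1)])
    then have "cdf (distr (density lborel (\<lambda>t. ennreal (p (x, t)))) borel (g_map f p x)) s
        = measure (density lborel (\<lambda>t. ennreal (p (x, t)))) {..y}"
      by (simp add: cdf_def measure_distr vimage_def)
    also have "\<dots> = (LINT t:{..y}|lborel. p (x, t))"
      by (intro measure_density_eq_set_integral p_fiber less_imp_le[OF p_pos]) auto
    \<comment> \<open>The common nonzero marginal cancels from the two quotients.\<close>
    also have "\<dots> = (LINT t:{..s}|lborel. f (x, t))"
      using y dens by (simp add: cdf_X2_X1_def)
    also have "\<dots> = cdf (density lborel (\<lambda>t. ennreal (f (x, t)))) s"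
      unfolding cdf_def
      by (intro measure_density_eq_set_integral[symmetric] intf less_imp_le[OF f_pos]) auto
    finally show "cdf (distr (density lborel (\<lambda>t. ennreal (p (x, t)))) borel (g_map f p x)) s
      = cdf (density lborel (\<lambda>t. ennreal (f (x, t)))) s" .
  qed
qed

end

section \<open>From fibres to joint laws and costs\<close>

lemma measurable_pair_lborel_components:
  fixes X Y :: "'a \<Rightarrow> real"
  assumes "(\<lambda>w. (X w, Y w)) \<in> M \<rightarrow>\<^sub>M lborel"
  shows "X \<in> borel_measurable M" "Y \<in> borel_measurable M"
proof -
  have "(\<lambda>w. (X w, Y w)) \<in> M \<rightarrow>\<^sub>M borel \<Otimes>\<^sub>M borel"
    using assms unfolding borel_prod by simp
  from measurable_compose[OF this measurable_fst] measurable_compose[OF this measurable_snd]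
  show "X \<in> borel_measurable M" "Y \<in> borel_measurable M"
    unfolding fst_conv snd_conv .
qed

lemma (in prob_space) distributed_pair_marginal:
  fixes X Y :: "'a \<Rightarrow> real"
  assumes "distributed M lborel (\<lambda>w. (X w, Y w)) f"
  shows "distributed M lborel X (\<lambda>x. \<integral>\<^sup>+t. f (x, t) \<partial>lborel)"
  by (rule distr_marginal1[OF lborel.sigma_finite_measure_axioms lborel.sigma_finite_measure_axioms
        assms[folded lborel_prod]])

context prob_space
begin

context
  fixes X Y Z :: "'a \<Rightarrow> real" and f p :: "real \<times> real \<Rightarrow> real"
  assumes XZ: "distributed M lborel (\<lambda>w. (X w, Z w)) (\<lambda>z. ennreal (f z))"
    and XY: "distributed M lborel (\<lambda>w. (X w, Y w)) (\<lambda>z. ennreal (p z))"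
    and f_pos: "\<And>z. 0 < f z" and p_pos: "\<And>z. 0 < p z"
begin

lemma density_measurable: "f \<in> borel_measurable borel" "p \<in> borel_measurable borel"
  using distributed_real_measurable[OF _ XZ] distributed_real_measurable[OF _ XY] f_pos p_pos
  by (auto simp: less_imp_le)

lemma random_variables:
  "X \<in> borel_measurable M" "Y \<in> borel_measurable M" "Z \<in> borel_measurable M"
  by (rule measurable_pair_lborel_components distributed_measurable XZ XY)+

lemma g_map_measurable:
  "case_prod (g_map f p) \<in> borel_measurable borel"
  "case_prod (g_map f p) \<in> borel_measurable (borel \<Otimes>\<^sub>M borel)"
  using measurable_g_map[OF density_measurable(1) f_pos density_measurable(2)]
  by (simp_all add: borel_prod)

lemma random_variable_g_map: "(\<lambda>w. g_map f p (X w) (Y w)) \<in> borel_measurable M"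
  using measurable_compose[OF measurable_Pair[OF random_variables(1,2)] g_map_measurable(2)]
  by simp

text \<open>The marginals of \<open>f\<close> and \<open>p\<close> are both densities of
  \<open>X\<close>, hence agree almost everywhere; since their total mass is 1, the marginal
  integral of \<open>f\<close> is finite on almost every fibre.\<close>

lemma AE_dens_X1_eq: "AE x in lborel. dens_X1 f x \<noteq> 0 \<and> dens_X1 p x = dens_X1 f x"
proof -
  note marg = distributed_pair_marginal[OF XZ] distributed_pair_marginal[OF XY]
  have "(\<integral>\<^sup>+x. \<integral>\<^sup>+t. f (x, t) \<partial>lborel \<partial>lborel) = emeasure (distr M lborel X) UNIV"
    unfolding distributed_distr_eq_density[OF marg(1)]
    using distributed_borel_measurable[OF marg(1)] by (simp add: emeasure_density)
  also have "\<dots> = 1"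
    using prob_space.emeasure_space_1[OF prob_space_distr[of X lborel]] random_variables(1) by simp
  finally have "AE x in lborel. (\<integral>\<^sup>+t. f (x, t) \<partial>lborel) \<noteq> \<infinity>"
    using distributed_borel_measurable[OF marg(1)] by (intro nn_integral_PInf_AE) auto
  with distributed_unique[OF marg] show ?thesis
  proof eventually_elim
    case (elim x)
    have meas: "(\<lambda>t. q (x, t)) \<in> borel_measurable lborel"
      if "q \<in> borel_measurable borel" for q :: "real \<times> real \<Rightarrow> real"
      using measurable_compose[OF _ that, of "\<lambda>t. (x, t)" lborel] by (simp add: borel_prod[symmetric])
    have "integrable lborel (\<lambda>t. f (x, t))"
      using elim meas[OF density_measurable(1)]
      by (intro integrableI_nonneg AE_I2 less_imp_le f_pos) (simp_all add: top.not_eq_extremum)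
    moreover have "dens_X1 p x = dens_X1 f x"
      unfolding dens_X1_def using elim(1) meas density_measurable
      by (subst (1 2) integral_eq_nn_integral) (auto intro!: less_imp_le f_pos p_pos)
    ultimately show ?case using dens_X1_nonzero_iff[OF density_measurable(1) f_pos] by simp
  qed
qed

lemma distr_pair_g_map:
  "distr M borel (\<lambda>w. (X w, g_map f p (X w) (Y w))) = density lborel (\<lambda>z. ennreal (f z))"
proof (rule measure_eqI)
  have fm: "f \<in> borel_measurable (borel \<Otimes>\<^sub>M borel)" and pm: "p \<in> borel_measurable (borel \<Otimes>\<^sub>M borel)"
    using density_measurable by (simp_all add: borel_prod)
  fix S assume "S \<in> sets (distr M borel (\<lambda>w. (X w, g_map f p (X w) (Y w))))"
  then have S: "S \<in> sets borel" by simp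
  then have S': "S \<in> sets (borel \<Otimes>\<^sub>M borel)" unfolding borel_prod .
  have ind: "(\<lambda>z. indicator S z :: ennreal) \<in> borel_measurable (borel \<Otimes>\<^sub>M borel)"
    using S' by (rule borel_measurable_indicator)
  have "(\<lambda>z. (fst z, g_map f p (fst z) (snd z))) \<in> borel \<Otimes>\<^sub>M borel \<rightarrow>\<^sub>M borel \<Otimes>\<^sub>M borel"
    using g_map_measurable(2) by (intro measurable_Pair measurable_fst) (simp add: case_prod_beta')
  from measurable_compose[OF this ind]
  have ind_g: "(\<lambda>z. indicator S (fst z, g_map f p (fst z) (snd z)) :: ennreal) \<in> borel_measurable (borel \<Otimes>\<^sub>M borel)" .
  have Xg: "(\<lambda>w. (X w, g_map f p (X w) (Y w))) \<in> borel_measurable M"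
    unfolding borel_prod[symmetric] by (intro measurable_Pair random_variables random_variable_g_map)
  have iter: "(\<integral>\<^sup>+z. k z \<partial>lborel) = (\<integral>\<^sup>+x. \<integral>\<^sup>+y. k (x, y) \<partial>lborel \<partial>lborel)"
    if "k \<in> borel_measurable (borel \<Otimes>\<^sub>M borel)" for k :: "real \<times> real \<Rightarrow> ennreal"
    unfolding lborel_prod[symmetric] using that
    by (subst lborel.nn_integral_fst[symmetric]) (simp_all cong: measurable_cong_sets)
  have "emeasure (distr M borel (\<lambda>w. (X w, g_map f p (X w) (Y w)))) S
      = (\<integral>\<^sup>+z. indicator S z \<partial>distr M borel (\<lambda>w. (X w, g_map f p (X w) (Y w))))"
    using S by simp
  also have "\<dots> = (\<integral>\<^sup>+w. indicator S (X w, g_map f p (X w) (Y w)) \<partial>M)"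
    using S by (intro nn_integral_distr Xg) auto
  also have "\<dots> = (\<integral>\<^sup>+z. ennreal (p z) * indicator S (fst z, g_map f p (fst z) (snd z)) \<partial>lborel)"
    using distributed_nn_integral[OF XY, of "\<lambda>z. indicator S (fst z, g_map f p (fst z) (snd z))"]
      ind_g by (simp add: borel_prod)
  also have "\<dots> = (\<integral>\<^sup>+x. \<integral>\<^sup>+y. ennreal (p (x, y)) * indicator S (x, g_map f p x y) \<partial>lborel \<partial>lborel)"
    by (subst iter) (auto intro!: borel_measurable_times_ennreal measurable_compose[OF pm] ind_g)
  \<comment> \<open>The inner integrals agree on every good fibre by the quantile transform, and
    almost every fibre is good.\<close>
  also have "\<dots> = (\<integral>\<^sup>+x. \<integral>\<^sup>+t. ennreal (f (x, t)) * indicator S (x, t) \<partial>lborel \<partial>lborel)"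
    using AE_dens_X1_eq
  proof (intro nn_integral_cong_AE, eventually_elim)
    case (elim x)
    have pair: "(\<lambda>t. (x, t)) \<in> borel \<rightarrow>\<^sub>M borel \<Otimes>\<^sub>M borel" by simp
    have gx: "g_map f p x \<in> borel_measurable borel"
      using measurable_compose[OF pair g_map_measurable(2)] by simp
    have fx: "(\<lambda>t. ennreal (f (x, t))) \<in> borel_measurable lborel"
      and px: "(\<lambda>t. ennreal (p (x, t))) \<in> borel_measurable lborel"
      using measurable_compose[OF pair fm] measurable_compose[OF pair pm] by simp_all
    have Sx: "(\<lambda>t. indicator S (x, t) :: ennreal) \<in> borel_measurable borel"
      using measurable_compose[OF pair ind] .
    have "(\<integral>\<^sup>+y. ennreal (p (x, y)) * indicator S (x, g_map f p x y) \<partial>lborel)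
        = (\<integral>\<^sup>+y. indicator S (x, g_map f p x y) \<partial>density lborel (\<lambda>t. ennreal (p (x, t))))"
      using measurable_compose[OF gx Sx] px by (subst nn_integral_density) auto
    also have "\<dots> = (\<integral>\<^sup>+y. indicator S (x, y) \<partial>distr (density lborel (\<lambda>t. ennreal (p (x, t)))) borel (g_map f p x))"
      using gx Sx by (subst nn_integral_distr) auto
    also have "\<dots> = (\<integral>\<^sup>+y. indicator S (x, y) \<partial>density lborel (\<lambda>t. ennreal (f (x, t))))"
      using elim by (simp add: distr_g_map[OF density_measurable(1) f_pos density_measurable(2) p_pos])
    also have "\<dots> = (\<integral>\<^sup>+t. ennreal (f (x, t)) * indicator S (x, t) \<partial>lborel)"
      using Sx fx by (subst nn_integral_density) auto
    finally show ?case .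
  qed
  also have "\<dots> = (\<integral>\<^sup>+z. ennreal (f z) * indicator S z \<partial>lborel)"
    by (subst iter) (auto intro!: borel_measurable_times_ennreal measurable_compose[OF fm] ind)
  also have "\<dots> = emeasure (density lborel (\<lambda>z. ennreal (f z))) S"
    using S density_measurable(1) by (subst emeasure_density) auto
  finally show "emeasure (distr M borel (\<lambda>w. (X w, g_map f p (X w) (Y w)))) S
      = emeasure (density lborel (\<lambda>z. ennreal (f z))) S" .
qed (simp only: sets_distr sets_density sets_lborel)

lemma g_map_cost_le:
  "(\<integral>\<^sup>+w. ennreal ((g_map f p (X w) (Y w) - Y w)\<^sup>2) \<partial>M) \<le> (\<integral>\<^sup>+w. ennreal ((Z w - Y w)\<^sup>2) \<partial>M)"
proof (rule nn_integral_square_diff_monotone_map_le[OF random_variables g_map_measurable(1)])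
  have "distr M borel (\<lambda>w. (X w, Z w)) = distr M lborel (\<lambda>w. (X w, Z w))"
    by (rule distr_cong) auto
  then show "distr M borel (\<lambda>w. (X w, g_map f p (X w) (Y w))) = distr M borel (\<lambda>w. (X w, Z w))"
    using distributed_distr_eq_density[OF XZ] distr_pair_g_map by simp
  note marg = distributed_pair_marginal[OF XZ]
  \<comment> \<open>The law of \<open>X\<close> has a Lebesgue density, so a Lebesgue-null set of
    bad fibres is avoided almost surely.\<close>
  have "AE x in distr M lborel X. dens_X1 f x \<noteq> 0 \<and> dens_X1 p x = dens_X1 f x"
    unfolding distributed_distr_eq_density[OF marg]
    using AE_dens_X1_eq distributed_borel_measurable[OF marg] by (subst AE_density) auto
  then have "AE w in M. dens_X1 f (X w) \<noteq> 0 \<and> dens_X1 p (X w) = dens_X1 f (X w)"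
    by (rule AE_distrD[OF distributed_measurable[OF marg]])
  then show "AE w in M. mono (g_map f p (X w))"
    by eventually_elim (simp add: mono_g_map[OF density_measurable(1) f_pos density_measurable(2) p_pos])
qed

end

end

section \<open>Exchange of coordinates and assembly of the coupling\<close>

lemma continuous_on_smooth: "smooth f \<Longrightarrow> continuous_on UNIV f"
  unfolding smooth_def k_times_cont_diff.simps(1)[symmetric] by (rule spec)

text \<open>All facts about \<open>g_map\<close> carry over to \<open>h_map\<close> through this
  identity.\<close>

lemma h_map_eq_g_map_swap: "h_map ft p x y = g_map (ft \<circ> prod.swap) (p \<circ> prod.swap) y x"
  by (simp add: h_map_def g_map_def Gt_inv_def G_inv_def cdf_Y1_Y2_def cdf_X2_X1_def
      cdf_X1_Y2_def cdf_Y2_X1_def dens_Y2_def dens_X1_def)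

lemma distributed_lborel_swap:
  fixes X Y :: "'a \<Rightarrow> real"
  assumes "prob_space M" "distributed M lborel (\<lambda>w. (X w, Y w)) (\<lambda>z. ennreal (f z))"
  shows "distributed M lborel (\<lambda>w. (Y w, X w)) (\<lambda>z. ennreal ((f \<circ> prod.swap) z))"
proof -
  interpret prob_space M by fact
  have sf: "sigma_finite_measure (lborel :: real measure)" ..
  show ?thesis
    using distributed_swap[OF sf sf assms(2)[folded lborel_prod]]
    by (simp add: lborel_prod case_prod_beta' prod.swap_def comp_def)
qed

lemma transport_cost_prod:
  fixes X1 X2 Y1 Y2 :: "'a \<Rightarrow> real"
  assumes [measurable]: "X1 \<in> borel_measurable M" "X2 \<in> borel_measurable M"
    "Y1 \<in> borel_measurable M" "Y2 \<in> borel_measurable M"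
  shows "transport_cost M (\<lambda>w. (X1 w, X2 w)) (\<lambda>w. (Y1 w, Y2 w))
    = (\<integral>\<^sup>+w. ennreal ((X1 w - Y1 w)\<^sup>2) \<partial>M) + (\<integral>\<^sup>+w. ennreal ((X2 w - Y2 w)\<^sup>2) \<partial>M)"
proof -
  have "(\<integral>\<^sup>+w. ennreal ((X1 w - Y1 w)\<^sup>2) \<partial>M) + (\<integral>\<^sup>+w. ennreal ((X2 w - Y2 w)\<^sup>2) \<partial>M)
      = (\<integral>\<^sup>+w. ennreal ((X1 w - Y1 w)\<^sup>2) + ennreal ((X2 w - Y2 w)\<^sup>2) \<partial>M)"
    by (rule nn_integral_add[symmetric]) measurable
  then show ?thesis
    by (simp add: transport_cost_def norm_Pair)
qed

theorem mainTheorem2: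
  fixes M :: "'w measure"
    and F G :: "(real \<times> real) measure"
    and f ft p :: "real \<times> real \<Rightarrow> real"
    and X1 X2 Y1 Y2 :: "'w \<Rightarrow> real"
  assumes "prob_space M" and "non_atomic M"
    and "prob_space F" and "F = density lborel (\<lambda>z. ennreal (f z))"
    and "smooth f" and "\<forall>z. 0 < f z"
    and "prob_space G" and "G = density lborel (\<lambda>z. ennreal (ft z))"
    and "smooth ft" and "\<forall>z. 0 < ft z"
    and "optimal_coupling M F G (\<lambda>w. (X1 w, X2 w)) (\<lambda>w. (Y1 w, Y2 w))"
    and "distributed M lborel (\<lambda>w. (X1 w, Y2 w)) (\<lambda>z. ennreal (p z))"
    and "smooth p" and "\<forall>z. 0 < p z"
  shows "optimal_coupling M F G
           (\<lambda>w. (X1 w, g_map f p (X1 w) (Y2 w)))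
           (\<lambda>w. (h_map ft p (X1 w) (Y2 w), Y2 w))"
proof -
  interpret prob_space M by fact
  let ?g = "\<lambda>w. g_map f p (X1 w) (Y2 w)" and ?h = "\<lambda>w. h_map ft p (X1 w) (Y2 w)"
  have distr_lborel: "distr M lborel V = distr M borel V" for V :: "'w \<Rightarrow> real \<times> real"
    by (rule distr_cong) auto
  have meas: "(\<lambda>z. ennreal (f z)) \<in> borel_measurable borel" "(\<lambda>z. ennreal (ft z)) \<in> borel_measurable borel"
    by (intro measurable_compose[OF _ measurable_ennreal] borel_measurable_continuous_onI
        continuous_on_smooth assms)+
  have cpl: "coupling M F G (\<lambda>w. (X1 w, X2 w)) (\<lambda>w. (Y1 w, Y2 w))"
    using assms(11) by (simp add: optimal_coupling_def)
  have dX: "distributed M lborel (\<lambda>w. (X1 w, X2 w)) (\<lambda>z. ennreal (f z))"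
    and dY: "distributed M lborel (\<lambda>w. (Y1 w, Y2 w)) (\<lambda>z. ennreal (ft z))"
    using cpl meas assms(4,8) by (simp_all add: distributed_def coupling_def distr_lborel)
  have pos: "\<And>z. 0 < f z" "\<And>z. 0 < p z" "\<And>z. 0 < (ft \<circ> prod.swap) z" "\<And>z. 0 < (p \<circ> prod.swap) z"
    using assms(6,10,14) by (simp_all only: comp_def)
  \<comment> \<open>The triple (\<open>X\<close>, \<open>Y\<close>, \<open>Z\<close>) of the general
    lemmas becomes (\<open>X1\<close>, \<open>Y2\<close>, \<open>X2\<close>) here, and
    (\<open>Y2\<close>, \<open>X1\<close>, \<open>Y1\<close>) with swapped densities in
    \<open>dY'\<close>.\<close>
  note dX' = dX assms(12) pos(1,2)
  note dY' = distributed_lborel_swap[OF assms(1) dY] distributed_lborel_swap[OF assms(1,12)] pos(3,4)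
  note rv = random_variables[OF dX'] random_variables[OF dY']
    random_variable_g_map[OF dX'] random_variable_g_map[OF dY', folded h_map_eq_g_map_swap]
  \<comment> \<open>The law comes out with the coordinates exchanged and is swapped back
    afterwards.\<close>
  have "distributed M lborel (\<lambda>w. (Y2 w, ?h w)) (\<lambda>z. ennreal ((ft \<circ> prod.swap) z))"
    using distr_pair_g_map[OF dY', folded h_map_eq_g_map_swap] distributed_borel_measurable[OF dY'(1)]
      measurable_Pair[OF rv(2,8)]
    by (simp add: distributed_def distr_lborel borel_prod)
  from distributed_distr_eq_density[OF distributed_lborel_swap[OF assms(1) this]]
  have "distr M borel (\<lambda>w. (?h w, Y2 w)) = G"
    using assms(8) by (simp add: distr_lborel comp_def)
  then have "coupling M F G (\<lambda>w. (X1 w, ?g w)) (\<lambda>w. (?h w, Y2 w))"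
    using distr_pair_g_map[OF dX'] assms(4) measurable_Pair[OF rv(1,7)] measurable_Pair[OF rv(8,2)]
    by (simp add: coupling_def borel_prod)
  moreover have "transport_cost M (\<lambda>w. (X1 w, ?g w)) (\<lambda>w. (?h w, Y2 w))
      \<le> transport_cost M (\<lambda>w. (X1 w, X2 w)) (\<lambda>w. (Y1 w, Y2 w))"
    \<comment> \<open>The swapped instance bounds the cost in the first coordinate, the direct one
      that in the second.\<close>
    using add_mono[OF g_map_cost_le[OF dY', folded h_map_eq_g_map_swap] g_map_cost_le[OF dX']]
    by (simp add: transport_cost_prod rv power2_commute[of "X1 _"])
  ultimately show ?thesis
    using assms(11) unfolding optimal_coupling_def by (blast intro: order_trans)
qed

end
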